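(* Let $\mathcal{M},\mathcal{N},\mathcal{S}$ be subspaces of $\mathcal{H}$ satisfying the idempotency condition, and let $E=P_{\mathcal{M},\mathcal{N},\mathcal{S}}$. Then $E^*$ is idempotent if and only if $$\overline{E}=P_{\overline{\mathcal{M}+\mathcal{S}},\,\overline{\mathcal{N}+\mathcal{S}}}\cap(\overline{\mathcal{M}+\mathcal{N}}\times\mathcal{H})$$ and $\overline{\mathcal{M}+\mathcal{S}}+\overline{\mathcal{N}+\mathcal{S}}+\overline{\mathcal{M}+\mathcal{N}}$ is closed.
   Context: $\mathcal{H}$ is a complex separable Hilbert space; "subspace" means linear subspace, not necessarily closed. A linear relation on $\mathcal{H}$ is a linear subspace $T$ of $\mathcal{H}\times\mathcal{H}$; its closure $\overline{T}$ is taken in $\mathcal{H}\times\mathcal{H}$, and its adjoint is $T^*=\{(x,y)\in\mathcal{H}\times\mathcal{H}:\langle g,x\rangle=\langle f,y\rangle\text{ for all }(f,g)\in T\}$. Product: $ST=\{(x,y): (x,z)\in T,\ (z,y)\in S \text{ for some } z\}$; $T$ is idempotent if $T^2=TT=T$. For subspaces $\mathcal{M},\mathcal{N}$ of $\mathcal{H}$, $P_{\mathcal{M},\mathcal{N}}:=\{(m+n,m): m\in\mathcal{M},\ n\in\mathcal{N}\}$. Subspaces $\mathcal{M},\mathcal{N},\mathcal{S}$ satisfy the idempotency condition if $(\mathcal{M}+\mathcal{N})\cap\mathcal{S}=\mathcal{M}\cap\mathcal{N}$; in that case $P_{\mathcal{M},\mathcal{N},\mathcal{S}}:=P_{\mathcal{M},\mathcal{N}}\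 \hat{+}\ (\{0\}\times\mathcal{S})$, where $\hat{+}$ is the sum of subspaces of $\mathcal{H}\times\mathcal{H}$. *)

theory Defs
  imports "HOL-Analysis.Analysis" "HOL-Library.Set_Algebras"
begin

class complex_vector = real_vector +
  fixes scaleC :: "complex \<Rightarrow> 'a \<Rightarrow> 'a"  (infixr \<open>*\<^sub>C\<close> 75)
  assumes scaleR_scaleC: "scaleR r x = complex_of_real r *\<^sub>C x"
    and scaleC_add_right: "a *\<^sub>C (x + y) = a *\<^sub>C x + a *\<^sub>C y"
    and scaleC_add_left: "(a + b) *\<^sub>C x = a *\<^sub>C x + b *\<^sub>C x"
    and scaleC_scaleC: "a *\<^sub>C (b *\<^sub>C x) = (a * b) *\<^sub>C x"
    and scaleC_one: "1 *\<^sub>C x = x"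

global_interpretation complex_vector:
  vector_space "scaleC :: complex \<Rightarrow> 'a \<Rightarrow> 'a::complex_vector"
  by unfold_locales
    (rule scaleC_add_right scaleC_add_left scaleC_scaleC scaleC_one)+

text \<open>Linear in the first argument. The metric and the topology are the ones
  induced by the norm (via \<^class>\<open>real_normed_vector\<close>).\<close>

class complex_inner = complex_vector + real_normed_vector +
  fixes cinner :: "'a \<Rightarrow> 'a \<Rightarrow> complex"
  assumes cinner_commute: "cinner x y = cnj (cinner y x)"
    and cinner_add_left: "cinner (x + y) z = cinner x z + cinner y z"
    and cinner_scaleC_left: "cinner (a *\<^sub>C x) y = a * cinner x y"
    and cinner_self: "cinner x x = complex_of_real ((norm x)\<^sup>2)"

class chilbert_space = complex_inner + complete_space

instantiation prod :: (complex_vector, complex_vector) complex_vector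
begin

definition scaleC_prod_def: "a *\<^sub>C p = (a *\<^sub>C fst p, a *\<^sub>C snd p)"

instance
  by standard
    (simp_all add: scaleC_prod_def scaleR_prod_def scaleR_scaleC prod_eq_iff
      scaleC_add_right scaleC_add_left scaleC_scaleC scaleC_one)

end

instantiation complex :: chilbert_space
begin

definition scaleC_complex_def: "a *\<^sub>C (x::complex) = a * x"
definition cinner_complex_def: "cinner (x::complex) y = x * cnj y"

instance
proof
  fix x y z :: complex and a b :: complex and r :: real
  show "r *\<^sub>R x = complex_of_real r *\<^sub>C x"
    by (simp only: scaleC_complex_def scaleR_conv_of_real)
  show "a *\<^sub>C (x + y) = a *\<^sub>C x + a *\<^sub>C y"
    by (simp only: scaleC_complex_def distrib_left)
  show "(a + b) *\<^sub>C x = a *\<^sub>C x + b *\<^sub>C x"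
    by (simp only: scaleC_complex_def distrib_right)
  show "a *\<^sub>C b *\<^sub>C x = (a * b) *\<^sub>C x"
    by (simp only: scaleC_complex_def mult.assoc)
  show "1 *\<^sub>C x = x"
    by (simp only: scaleC_complex_def mult_1_left)
  show "cinner x y = cnj (cinner y x)"
    by (simp add: cinner_complex_def mult.commute)
  show "cinner (x + y) z = cinner x z + cinner y z"
    by (simp only: cinner_complex_def distrib_right)
  show "cinner (a *\<^sub>C x) y = a * cinner x y"
    by (simp only: cinner_complex_def scaleC_complex_def mult.assoc)
  show "cinner x x = complex_of_real ((norm x)\<^sup>2)"
    by (simp only: cinner_complex_def complex_norm_square)
qed

end

abbreviation csubspace :: "'a::complex_vector set \<Rightarrow> bool"
  where "csubspace \<equiv> complex_vector.subspace"

definition radjoint :: "('a::complex_inner \<times> 'a) set \<Rightarrow> ('a \<times> 'a) set"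
  where "radjoint T = {(x, y). \<forall>(f, g) \<in> T. cinner g x = cinner f y}"

text \<open>With the convention of the library, \<^term>\<open>T O S\<close> applies \<^term>\<open>T\<close> first; it is the
  product written \<open>ST\<close> for linear relations.\<close>

definition idempotent_rel :: "('a \<times> 'a) set \<Rightarrow> bool"
  where "idempotent_rel T \<longleftrightarrow> T O T = T"

definition idempotency_condition :: "'a::plus set \<Rightarrow> 'a set \<Rightarrow> 'a set \<Rightarrow> bool"
  where "idempotency_condition M N S \<longleftrightarrow> (M + N) \<inter> S = M \<inter> N"

definition proj_rel :: "'a::plus set \<Rightarrow> 'a set \<Rightarrow> ('a \<times> 'a) set"
  where "proj_rel M N = {(m + n, m) | m n. m \<in> M \<and> n \<in> N}"

text \<open>The sum below is the elementwise sum of subsets of the product space.\<close>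

definition proj_rel3 :: "'a::monoid_add set \<Rightarrow> 'a set \<Rightarrow> 'a set \<Rightarrow> ('a \<times> 'a) set"
  where "proj_rel3 M N S = proj_rel M N + ({0} \<times> S)"

lemma csubspace_radjoint: "csubspace (radjoint T)"
proof -
  have add: "cinner x (y + z) = cinner x y + cinner x z" for x y z :: 'a
    by (subst (1 2 3) cinner_commute) (simp add: cinner_add_left)
  have scale: "cinner x (a *\<^sub>C y) = cnj a * cinner x y" for x y :: 'a and a
    by (subst (1 2) cinner_commute) (simp add: cinner_scaleC_left)
  have zero: "cinner x 0 = 0" for x :: 'a
    using add[of x 0 0] by simp
  show ?thesis
    unfolding complex_vector.subspace_def radjoint_def
    by (auto simp: scaleC_prod_def zero_prod_def add scale zero split_beta)
qed

end

(* Writing A, B, C for the orthogonal complements of M, N, S, the adjoint F of E consists of the pairs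
   (x, y) with x in C, y in B and x - y in A.  Hence F F is always contained in F, and F is idempotent
   iff F is the relation G = P_{V,U,W} with U = A Int C, V = B Int C, W = A Int B, which F contains.
   The adjoint of G is the right-hand side of the displayed equation, and the adjoint of F is the closure
   of E; so F = G iff the equation holds and G is closed.  As G is the sum of U x W and the diagonal
   of V, the theorem "X + Y is closed iff the sum of the complements of X and Y is closed" turns
   closedness of G into closedness of the sum of the complements of U, V and W. *)
theory Submission
  imports Defs
begin

section \<open>Orthogonal complements\<close>

lemma cinner_add_right: "cinner x (y + z) = cinner x y + cinner x (z::'a::complex_inner)"
  by (subst (1 2 3) cinner_commute) (simp add: cinner_add_left)

lemma cinner_scaleC_right: "cinner x (a *\<^sub>C y) = cnj a * cinner x (y::'a::complex_inner)"
  by (subst (1 2) cinner_commute) (simp add: cinner_scaleC_left)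

lemma cinner_zero_left [simp]: "cinner 0 (x::'a::complex_inner) = 0"
  using cinner_add_left[of 0 0 x] by simp

lemma cinner_zero_right [simp]: "cinner (x::'a::complex_inner) 0 = 0"
  using cinner_add_right[of x 0 0] by simp

lemma cinner_minus_left [simp]: "cinner (- x) y = - cinner x (y::'a::complex_inner)"
  using cinner_add_left[of x "- x" y] by (simp add: add_eq_0_iff)

lemma cinner_minus_right [simp]: "cinner x (- y) = - cinner x (y::'a::complex_inner)"
  using cinner_add_right[of x y "- y"] by (simp add: add_eq_0_iff)

lemma cinner_diff_left: "cinner (x - y) z = cinner x z - cinner y (z::'a::complex_inner)"
  using cinner_add_left[of x "- y" z] by simp

lemma cinner_diff_right: "cinner x (y - z) = cinner x y - cinner x (z::'a::complex_inner)"
  using cinner_add_right[of x y "- z"] by simp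

lemma cinner_eq_zero_commute: "cinner x y = 0 \<longleftrightarrow> cinner y (x::'a::complex_inner) = 0"
  by (metis cinner_commute complex_cnj_zero)

text \<open>The class axioms make the norm homogeneous for real scalars only; for complex ones this
  follows from \<open>cinner_self\<close>, since \<open>c * cnj c\<close> is the squared
  modulus.\<close>

lemma norm_scaleC: "norm (c *\<^sub>C x) = cmod c * norm (x::'a::complex_inner)"
proof -
  have "complex_of_real ((norm (c *\<^sub>C x))\<^sup>2) = (c * cnj c) * complex_of_real ((norm x)\<^sup>2)"
    by (simp only: cinner_self[symmetric] cinner_scaleC_left cinner_scaleC_right mult_ac)
  also have "\<dots> = complex_of_real ((cmod c * norm x)\<^sup>2)"
    by (simp only: complex_norm_square[symmetric] of_real_mult power_mult_distrib)
  finally have "(norm (c *\<^sub>C x))\<^sup>2 = (cmod c * norm x)\<^sup>2"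
    by (simp only: of_real_eq_iff)
  then show ?thesis
    by (rule power2_eq_imp_eq) auto
qed

lemma bounded_linear_scaleC_right: "bounded_linear (\<lambda>x::'a::complex_inner. c *\<^sub>C x)"
  by (rule bounded_linear_intro[of _ "cmod c"])
    (simp_all add: scaleC_add_right scaleR_scaleC scaleC_scaleC mult.commute norm_scaleC)

lemma norm_add_squared:
  "(norm (x + y))\<^sup>2 = (norm x)\<^sup>2 + (norm y)\<^sup>2 + 2 * Re (cinner x (y::'a::complex_inner))"
proof -
  have "Re (cinner y x) = Re (cinner x y)"
    by (subst cinner_commute) simp
  moreover have "Re (cinner v v) = (norm v)\<^sup>2" for v :: 'a
    by (simp add: cinner_self)
  moreover have "cinner (x + y) (x + y) = cinner x x + cinner y y + (cinner x y + cinner y x)"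
    by (simp add: cinner_add_left cinner_add_right algebra_simps)
  ultimately show ?thesis
    by (metis mult_2 plus_complex.simps(1))
qed

lemma parallelogram_law:
  "(norm (x + y))\<^sup>2 + (norm (x - y))\<^sup>2 = 2 * (norm x)\<^sup>2 + 2 * (norm (y::'a::complex_inner))\<^sup>2"
  using norm_add_squared[of x y] norm_add_squared[of x "- y"] by simp

text \<open>Pythagoras: the cross term vanishes and the square of \<open>norm y\<close> is
  nonnegative.\<close>

lemma norm_le_norm_add_orthogonal:
  "cinner x (y::'a::complex_inner) = 0 \<Longrightarrow> norm x \<le> norm (x + y)"
  using norm_add_squared[of x y] by (simp add: power2_le_imp_le)

text \<open>For \<open>y = 0\<close> the statement survives because of \<open>z / 0 = 0\<close>.\<close>

lemma norm_minus_projection_squared: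
  fixes x y :: "'a::complex_inner"
  defines "t \<equiv> cinner x y / complex_of_real ((norm y)\<^sup>2)"
  shows "(norm (x - t *\<^sub>C y))\<^sup>2 = (norm x)\<^sup>2 - (cmod (cinner x y))\<^sup>2 / (norm y)\<^sup>2"
proof (cases "y = 0")
  case False
  let ?p = "t *\<^sub>C y"
  have "cinner (x - ?p) y = 0"
    using False by (simp add: t_def cinner_diff_left cinner_scaleC_left cinner_self)
  then have "cinner (x - ?p) ?p = 0"
    by (simp add: cinner_scaleC_right)
  then have "(norm x)\<^sup>2 = (norm (x - ?p))\<^sup>2 + (norm ?p)\<^sup>2"
    using norm_add_squared[of "x - ?p" ?p] by simp
  moreover have "norm ?p = cmod (cinner x y) / norm y"
    using False by (simp add: norm_scaleC t_def norm_divide norm_mult power2_eq_square)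
  ultimately show ?thesis
    by (simp add: power_divide)
qed (simp add: t_def complex_vector.scale_zero_right)

text \<open>The residual of \<open>x\<close> after projection to the line through \<open>y\<close>
  has nonnegative squared norm.\<close>

lemma cauchy_schwarz: "cmod (cinner x y) \<le> norm x * norm (y::'a::complex_inner)"
proof (cases "y = 0")
  case False
  have "(cmod (cinner x y))\<^sup>2 / (norm y)\<^sup>2 \<le> (norm x)\<^sup>2"
    using norm_minus_projection_squared[of x y]
      zero_le_power2[of "norm (x - (cinner x y / complex_of_real ((norm y)\<^sup>2)) *\<^sub>C y)"] by linarith
  then have "(cmod (cinner x y))\<^sup>2 \<le> (norm x * norm y)\<^sup>2"
    using False by (simp add: divide_le_eq power_mult_distrib)
  then show ?thesis
    by (rule power2_le_imp_le) simp
qed simp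

lemma bounded_linear_cinner_left: "bounded_linear (\<lambda>x. cinner x (y::'a::complex_inner))"
proof (rule bounded_linear_intro)
  show "cmod (cinner x y) \<le> norm x * norm y" for x
    by (rule cauchy_schwarz)
qed (simp_all add: cinner_add_left scaleR_scaleC cinner_scaleC_left scaleC_complex_def)

lemma bounded_linear_cinner_right: "bounded_linear (\<lambda>y. cinner (x::'a::complex_inner) y)"
proof (rule bounded_linear_intro)
  show "cmod (cinner x y) \<le> norm y * norm x" for y
    using cauchy_schwarz[of x y] by (simp add: mult.commute)
qed (simp_all add: cinner_add_right scaleR_scaleC cinner_scaleC_right scaleC_complex_def)

lemmas continuous_on_cinner_left [continuous_intros] =
  bounded_linear.continuous_on[OF bounded_linear_cinner_left]

lemmas continuous_on_cinner_right [continuous_intros] =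
  bounded_linear.continuous_on[OF bounded_linear_cinner_right]

section \<open>Complements of subspaces and the projection theorem\<close>

definition ocomp :: "'a::complex_inner set \<Rightarrow> 'a set"
  where "ocomp X = {y. \<forall>x\<in>X. cinner x y = 0}"

lemma csubspace_ocomp: "csubspace (ocomp X)"
  by (auto simp: complex_vector.subspace_def ocomp_def cinner_add_right cinner_scaleC_right)

lemma closed_ocomp: "closed (ocomp X)"
proof -
  have "ocomp X = (\<Inter>x\<in>X. {y. cinner x y = 0})"
    by (auto simp: ocomp_def)
  then show ?thesis
    by (auto intro!: closed_Collect_eq continuous_intros)
qed

lemma ocomp_antimono: "X \<subseteq> Y \<Longrightarrow> ocomp Y \<subseteq> ocomp X"
  by (auto simp: ocomp_def)

text \<open>Orthogonality to a fixed vector is a closed condition. This permits projecting onto the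
  closure of a subspace that is not closed while keeping the same complement.\<close>

lemma ocomp_closure: "ocomp (closure X) = ocomp X"
proof
  have "closed {x. cinner x y = 0}" for y :: 'a
    by (intro closed_Collect_eq continuous_intros)
  then have "closure X \<subseteq> {x. cinner x y = 0}" if "y \<in> ocomp X" for y
    using that by (intro closure_minimal) (auto simp: ocomp_def)
  then show "ocomp X \<subseteq> ocomp (closure X)"
    by (auto simp: ocomp_def)
qed (simp add: ocomp_antimono closure_subset)

lemma csubspace_set_plus: "csubspace X \<Longrightarrow> csubspace Y \<Longrightarrow> csubspace (X + Y)"
  using complex_vector.subspace_sums[of X Y]
  by (simp add: set_plus_def Bex_def) (simp add: conj_ac ex_simps)

lemma ocomp_set_plus:
  assumes "csubspace X" "csubspace Y"
  shows "ocomp (X + Y) = ocomp X \<inter> ocomp Y"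
proof -
  have "X \<subseteq> X + Y" "Y \<subseteq> X + Y"
    using assms[THEN complex_vector.subspace_0] set_plus_intro[of _ X 0 Y] set_plus_intro[of 0 X _ Y]
    by force+
  then show ?thesis
    by (auto dest: ocomp_antimono) (auto simp: ocomp_def cinner_add_left elim!: set_plus_elim)
qed

lemma csubspace_closure:
  fixes X :: "'a::complex_inner set"
  assumes "csubspace X"
  shows "csubspace (closure X)"
proof (rule complex_vector.subspaceI)
  show "0 \<in> closure X"
    using assms complex_vector.subspace_0 closure_subset by blast
next
  fix x y assume "x \<in> closure X" "y \<in> closure X"
  then obtain f g where fg: "\<And>n. f n \<in> X" "f \<longlonglongrightarrow> x" "\<And>n. g n \<in> X" "g \<longlonglongrightarrow> y"
    unfolding closure_sequential by blast
  then show "x + y \<in> closure X"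
    unfolding closure_sequential
    by (intro exI[of _ "\<lambda>n. f n + g n"]) (simp add: assms complex_vector.subspace_add tendsto_add)
next
  fix c and x assume "x \<in> closure X"
  then obtain f where f: "\<And>n. f n \<in> X" "f \<longlonglongrightarrow> x"
    unfolding closure_sequential by blast
  have "(\<lambda>n. c *\<^sub>C f n) \<longlonglongrightarrow> c *\<^sub>C x"
    using bounded_linear_scaleC_right f(2) by (rule bounded_linear.tendsto)
  moreover have "c *\<^sub>C f n \<in> X" for n
    using assms f(1) by (rule complex_vector.subspace_scale)
  ultimately show "c *\<^sub>C x \<in> closure X"
    unfolding closure_sequential by (intro exI[of _ "\<lambda>n. c *\<^sub>C f n"]) auto
qed

text \<open>The projection is the nearest point: a minimizing sequence is Cauchy by the
  parallelogram law, and its limit has an orthogonal residual because otherwise it could be moved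
  closer to \<open>z\<close>.\<close>

lemma orthogonal_projection_exists:
  fixes X :: "'a::chilbert_space set"
  assumes X: "csubspace X" "closed X"
  obtains p where "p \<in> X" "z - p \<in> ocomp X"
proof -
  define d where "d = (INF x\<in>X. (norm (z - x))\<^sup>2)"
  have ne: "X \<noteq> {}"
    using X complex_vector.subspace_0 by blast
  have bdd: "bdd_below ((\<lambda>x. (norm (z - x))\<^sup>2) ` X)"
    by (rule bdd_belowI[of _ 0]) auto
  have d_le: "d \<le> (norm (z - x))\<^sup>2" if "x \<in> X" for x
    unfolding d_def using bdd that by (rule cINF_lower)
  have "\<exists>x\<in>X. (norm (z - x))\<^sup>2 < d + inverse (real (Suc n))" for n
    using cINF_less_iff[OF ne bdd, of "d + inverse (real (Suc n))"] by (simp add: d_def)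
  then obtain f where f: "\<And>n. f n \<in> X" "\<And>n. (norm (z - f n))\<^sup>2 < d + inverse (real (Suc n))"
    by metis
  \<comment> \<open>The midpoint of \<open>f m\<close> and \<open>f n\<close> lies in
    \<open>X\<close>, so its squared distance to \<open>z\<close> is at least \<open>d\<close>; the
    parallelogram law leaves only the two excesses over \<open>d\<close>.\<close>
  have diff: "(norm (f m - f n))\<^sup>2 \<le> 2 * inverse (real (Suc m)) + 2 * inverse (real (Suc n))" for m n
  proof -
    have "(1/2) *\<^sub>R (f m + f n) \<in> X"
      using X f(1) by (simp add: scaleR_scaleC complex_vector.subspace_add complex_vector.subspace_scale)
    then have "d \<le> (norm (z - (1/2) *\<^sub>R (f m + f n)))\<^sup>2"
      by (rule d_le)
    moreover have "(z - f m) + (z - f n) = 2 *\<^sub>R (z - (1/2) *\<^sub>R (f m + f n))"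
      by (simp add: algebra_simps scaleR_2)
    then have "(norm ((z - f m) + (z - f n)))\<^sup>2 = 4 * (norm (z - (1/2) *\<^sub>R (f m + f n)))\<^sup>2"
      by (simp only: norm_scaleR power_mult_distrib) simp
    moreover have "norm ((z - f m) - (z - f n)) = norm (f m - f n)"
      by (simp add: norm_minus_commute)
    ultimately show ?thesis
      using parallelogram_law[of "z - f m" "z - f n"] f(2)[of m] f(2)[of n] by simp
  qed
  have "Cauchy f"
  proof (rule metric_CauchyI)
    fix e :: real assume "0 < e"
    \<comment> \<open>The bound \<open>diff\<close> adds up to four such inverses, whence the factor
      1/4.\<close>
    then obtain N where N: "inverse (real (Suc N)) < e\<^sup>2 / 4"
      using reals_Archimedean[of "e\<^sup>2 / 4"] by auto
    have "dist (f m) (f n) < e" if "m \<ge> N" "n \<ge> N" for m n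
    proof -
      have "inverse (real (Suc m)) \<le> inverse (real (Suc N))" "inverse (real (Suc n)) \<le> inverse (real (Suc N))"
        using that by (simp_all add: field_simps)
      then have "(norm (f m - f n))\<^sup>2 < e\<^sup>2"
        using diff[of m n] N by linarith
      then show ?thesis
        using \<open>0 < e\<close> by (simp add: dist_norm power2_less_imp_less)
    qed
    then show "\<exists>N. \<forall>m\<ge>N. \<forall>n\<ge>N. dist (f m) (f n) < e"
      by blast
  qed
  then obtain p where p: "f \<longlonglongrightarrow> p"
    using Cauchy_convergent_iff convergent_def by blast
  then have "p \<in> X"
    using X(2) f(1) closed_sequentially by blast
  have "(norm (z - p))\<^sup>2 \<le> d + 0"
  proof (rule LIMSEQ_le)
    show "(\<lambda>n. (norm (z - f n))\<^sup>2) \<longlonglongrightarrow> (norm (z - p))\<^sup>2"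
      by (intro tendsto_intros p)
    show "(\<lambda>n. d + inverse (real (Suc n))) \<longlonglongrightarrow> d + 0"
      by (intro tendsto_intros LIMSEQ_inverse_real_of_nat)
    show "\<exists>N. \<forall>n\<ge>N. (norm (z - f n))\<^sup>2 \<le> d + inverse (real (Suc n))"
      using f(2) less_imp_le by blast
  qed
  have "cinner (z - p) x = 0" if "x \<in> X" for x
  proof -
    \<comment> \<open>Moving \<open>p\<close> by the projection of the residual to the line through
      \<open>x\<close> stays in \<open>X\<close> and lowers the squared distance by the quotient
      below, which must therefore vanish.\<close>
    let ?t = "cinner (z - p) x / complex_of_real ((norm x)\<^sup>2)"
    have "p + ?t *\<^sub>C x \<in> X"
      using X \<open>p \<in> X\<close> that by (simp add: complex_vector.subspace_add complex_vector.subspace_scale)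
    then have "d \<le> (norm (z - p - ?t *\<^sub>C x))\<^sup>2"
      using d_le by (metis diff_diff_eq)
    then have "(cmod (cinner (z - p) x))\<^sup>2 / (norm x)\<^sup>2 \<le> 0"
      using norm_minus_projection_squared[of "z - p" x] \<open>(norm (z - p))\<^sup>2 \<le> d + 0\<close> by linarith
    then show ?thesis
      by (cases "x = 0") (auto simp: divide_le_0_iff)
  qed
  then have "z - p \<in> ocomp X"
    by (simp add: ocomp_def cinner_eq_zero_commute)
  with \<open>p \<in> X\<close> show thesis
    by (rule that)
qed

text \<open>For \<open>z\<close> in the double complement, the residual of its projection to
  \<open>closure X\<close> lies in both \<open>ocomp X\<close> and \<open>ocomp (ocomp X)\<close>,
  so it is orthogonal to itself.\<close>

lemma ocomp_ocomp:
  fixes X :: "'a::chilbert_space set"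
  assumes "csubspace X"
  shows "ocomp (ocomp X) = closure X"
proof
  have "X \<subseteq> ocomp (ocomp X)"
    by (auto simp: ocomp_def cinner_eq_zero_commute)
  then show "closure X \<subseteq> ocomp (ocomp X)"
    by (intro closure_minimal closed_ocomp)
  show "ocomp (ocomp X) \<subseteq> closure X"
  proof
    fix z assume z: "z \<in> ocomp (ocomp X)"
    obtain p where p: "p \<in> closure X" "z - p \<in> ocomp X"
      using orthogonal_projection_exists[OF csubspace_closure[OF assms] closed_closure, of z]
      by (auto simp: ocomp_closure)
    have "z - p \<in> ocomp (ocomp X)"
      using z p(1) \<open>closure X \<subseteq> ocomp (ocomp X)\<close> csubspace_ocomp complex_vector.subspace_diff by blast
    with p(2) have "cinner (z - p) (z - p) = 0"
      by (auto simp: ocomp_def)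
    then show "z \<in> closure X"
      using p(1) by (simp add: cinner_self)
  qed
qed

section \<open>Closed sums of subspaces\<close>

text \<open>Uniform boundedness for the functionals given by the vectors of \<open>D\<close>, by
  Baire: the closed sets \<open>F n\<close> cover the space, so one of them contains a ball.\<close>

lemma weakly_bounded_imp_bounded:
  fixes D :: "'a::chilbert_space set"
  assumes "\<And>w. \<exists>b. \<forall>z\<in>D. cmod (cinner z w) \<le> b"
  shows "bounded D"
proof -
  define F where "F n = {w. \<forall>z\<in>D. cmod (cinner z w) \<le> real n}" for n
  have F_closed: "closed (F n)" for n
  proof -
    have "F n = (\<Inter>z\<in>D. {w. cmod (cinner z w) \<le> real n})"
      by (auto simp: F_def)
    then show ?thesis
      by (auto intro!: closed_Collect_le continuous_intros)
  qed
  have "w \<in> \<Union>(range F)" for w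
  proof -
    obtain b where "\<forall>z\<in>D. cmod (cinner z w) \<le> b"
      using assms by blast
    moreover obtain n where "b \<le> real n"
      using real_arch_simple by blast
    ultimately have "w \<in> F n"
      by (auto simp: F_def intro: order_trans)
    then show ?thesis
      by blast
  qed
  then have "\<Union>(range F) = UNIV"
    by blast
  then have "euclidean interior_of \<Union>(range F) \<noteq> {}"
    by simp
  then obtain n where "interior (F n) \<noteq> {}"
    using Baire_category_alt[of "euclidean :: 'a topology" "range F"] F_closed
      completely_metrizable_space_euclidean by auto
  then obtain w e where "0 < e" and ball: "cball w e \<subseteq> F n"
    using mem_interior_cball by blast
  \<comment> \<open>Testing \<open>z\<close> at the centre \<open>w\<close> and at the point of the
    ball at distance \<open>e\<close> in direction \<open>z\<close> gives two values of modulus at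
    most \<open>n\<close>, which differ by \<open>e * norm z\<close>.\<close>
  have "norm z \<le> 2 * real n / e" if "z \<in> D" for z
  proof (cases "z = 0")
    case False
    let ?v = "(e / norm z) *\<^sub>R z"
    have "w + ?v \<in> F n" "w \<in> F n"
      using ball \<open>0 < e\<close> False by (auto simp: dist_norm subset_iff)
    then have "cmod (cinner z (w + ?v)) \<le> real n" "cmod (cinner z w) \<le> real n"
      using that by (auto simp: F_def)
    then have "cmod (cinner z (w + ?v) - cinner z w) \<le> 2 * real n"
      using norm_triangle_ineq4[of "cinner z (w + ?v)" "cinner z w"] by linarith
    also have "cinner z (w + ?v) - cinner z w = complex_of_real (e * norm z)"
      using False
      by (simp add: cinner_add_right scaleR_scaleC cinner_scaleC_right cinner_self power2_eq_square)
    finally show ?thesis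
      using \<open>0 < e\<close> by (simp add: field_simps norm_mult)
  qed (use \<open>0 < e\<close> in simp)
  then show ?thesis
    unfolding bounded_iff by blast
qed

text \<open>Here \<open>p\<close> and \<open>q\<close> stand for the projections of \<open>z\<close> to \<open>X\<close> and \<open>Y\<close>. The bound is uniform boundedness:
  testing \<open>z\<close> against \<open>x + y\<close> only involves \<open>\<langle>p, x\<rangle> + \<langle>q, y\<rangle>\<close>.\<close>

lemma closed_sum_projection_bound:
  fixes X Y :: "'a::chilbert_space set"
  assumes X: "csubspace X" and Y: "csubspace Y" and cl: "closed (X + Y)"
  obtains C where "C > 0"
    and "\<And>z p q d. \<lbrakk>z \<in> X + Y; z - p \<in> ocomp X; z - q \<in> ocomp Y; norm p < d; norm q < d\<rbrakk>
      \<Longrightarrow> norm z \<le> C * d"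
proof -
  \<comment> \<open>Bounds of 1 suffice: \<open>z\<close>, \<open>p\<close> and \<open>q\<close>
    scale together, and the strict bounds by \<open>d\<close> force \<open>d\<close> to be
    positive.\<close>
  define D where "D = {z \<in> X + Y. \<exists>p q. z - p \<in> ocomp X \<and> z - q \<in> ocomp Y \<and> norm p \<le> 1 \<and> norm q \<le> 1}"
  have sub: "csubspace (X + Y)"
    using X Y by (rule csubspace_set_plus)
  have "bounded D"
  proof (rule weakly_bounded_imp_bounded)
    fix w
    \<comment> \<open>Vectors of \<open>X + Y\<close> see only the component \<open>v\<close> of
      \<open>w\<close> in this closed sum. Its parts \<open>x\<close> and \<open>y\<close> depend on
      \<open>w\<close> alone, so the bound is uniform in \<open>z\<close>.\<close>
    obtain v where v: "v \<in> X + Y" "w - v \<in> ocomp (X + Y)"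
      using orthogonal_projection_exists[OF sub cl] by blast
    from v(1) obtain x y where xy: "v = x + y" "x \<in> X" "y \<in> Y"
      by (rule set_plus_elim)
    have "cmod (cinner z w) \<le> norm x + norm y" if "z \<in> D" for z
    proof -
      from that obtain p q where pq: "z \<in> X + Y" "z - p \<in> ocomp X" "z - q \<in> ocomp Y" "norm p \<le> 1" "norm q \<le> 1"
        by (auto simp: D_def)
      have "cinner z (w - v) = 0"
        using pq(1) v(2) by (auto simp: ocomp_def)
      moreover have "cinner (z - p) x = 0" "cinner (z - q) y = 0"
        using pq xy by (auto simp: ocomp_def cinner_eq_zero_commute[of "z - p"] cinner_eq_zero_commute[of "z - q"])
      ultimately have eq: "cinner z w = cinner p x + cinner q y"
        using xy(1) by (simp add: cinner_diff_right cinner_diff_left cinner_add_right)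
      have "cmod (cinner z w) \<le> norm p * norm x + norm q * norm y"
        unfolding eq using norm_triangle_ineq[of "cinner p x" "cinner q y"] cauchy_schwarz[of p x] cauchy_schwarz[of q y]
        by linarith
      also have "\<dots> \<le> 1 * norm x + 1 * norm y"
        using pq by (intro add_mono mult_right_mono) auto
      finally show ?thesis
        by simp
    qed
    then show "\<exists>b. \<forall>z\<in>D. cmod (cinner z w) \<le> b"
      by blast
  qed
  then obtain C where C: "C > 0" "\<And>z. z \<in> D \<Longrightarrow> norm z \<le> C"
    using bounded_pos by blast
  have "norm z \<le> C * d"
    if z: "z \<in> X + Y" "z - p \<in> ocomp X" "z - q \<in> ocomp Y" "norm p < d" "norm q < d" for z p q d
  proof -
    have "0 < d"
      using z(4) norm_ge_zero[of p] by linarith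
    have scale: "inverse d *\<^sub>R v \<in> T" if "csubspace T" "v \<in> T" for v and T :: "'a set"
      using that by (simp add: scaleR_scaleC complex_vector.subspace_scale)
    have "inverse d *\<^sub>R z \<in> D"
      unfolding D_def
    proof (intro CollectI conjI exI)
      show "inverse d *\<^sub>R z \<in> X + Y"
        using scale[OF sub z(1)] .
      show "inverse d *\<^sub>R z - inverse d *\<^sub>R p \<in> ocomp X"
        using scale[OF csubspace_ocomp z(2)] by (simp add: scaleR_diff_right)
      show "inverse d *\<^sub>R z - inverse d *\<^sub>R q \<in> ocomp Y"
        using scale[OF csubspace_ocomp z(3)] by (simp add: scaleR_diff_right)
    qed (use z \<open>0 < d\<close> in \<open>auto simp: field_simps\<close>)
    then show ?thesis
      using C(2) \<open>0 < d\<close> by (force simp: field_simps)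
  qed
  with C(1) show thesis
    by (rule that)
qed

text \<open>If the first summands of a convergent sequence in the sum are chosen orthogonal to the
  intersection of the two complements, then they lie in \<open>X + Y\<close> and the previous bound makes them
  Cauchy.\<close>

lemma closed_ocomp_plus_ocomp:
  fixes X Y :: "'a::chilbert_space set"
  assumes X: "csubspace X" and Y: "csubspace Y" and cl: "closed (X + Y)"
  shows "closed (ocomp X + ocomp Y)"
proof -
  obtain C where "C > 0"
    and C: "\<And>z p q d. \<lbrakk>z \<in> X + Y; z - p \<in> ocomp X; z - q \<in> ocomp Y; norm p < d; norm q < d\<rbrakk>
      \<Longrightarrow> norm z \<le> C * d"
    using closed_sum_projection_bound[OF assms] by blast
  let ?I = "ocomp X \<inter> ocomp Y"
  have I: "csubspace ?I" "closed ?I"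
    by (simp_all add: complex_vector.subspace_inter csubspace_ocomp closed_Int closed_ocomp)
  \<comment> \<open>Closedness of \<open>X + Y\<close> makes it equal to its double
    complement.\<close>
  have ocompI: "ocomp ?I = X + Y"
    using ocomp_ocomp[OF csubspace_set_plus[OF X Y]] cl ocomp_set_plus[OF X Y] by simp
  note sub = csubspace_ocomp[THEN complex_vector.subspace_diff] csubspace_ocomp[THEN complex_vector.subspace_add]
  have split: "\<exists>x y. x \<in> ocomp X \<and> y \<in> ocomp Y \<and> x \<in> X + Y \<and> h = x + y" if "h \<in> ocomp X + ocomp Y" for h
  proof -
    from that obtain x y where xy: "h = x + y" "x \<in> ocomp X" "y \<in> ocomp Y"
      by (rule set_plus_elim)
    \<comment> \<open>The component of \<open>x\<close> in the intersection may be moved to the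
      second summand.\<close>
    obtain p where "p \<in> ?I" "x - p \<in> ocomp ?I"
      using orthogonal_projection_exists[OF I] by blast
    then show ?thesis
      using xy ocompI sub by (intro exI[of _ "x - p"] exI[of _ "y + p"]) auto
  qed
  have bound: "norm x \<le> C * d"
    if "x \<in> ocomp X" "x \<in> X + Y" "y \<in> ocomp Y" "norm (x + y) < d" for x y d
  proof -
    \<comment> \<open>With \<open>q\<close> the projection of \<open>x\<close> to
      \<open>closure Y\<close>, the rest of \<open>x + y\<close> is orthogonal to \<open>q\<close>,
      so \<open>q\<close> is no longer than \<open>x + y\<close>.\<close>
    obtain q where q: "q \<in> closure Y" "x - q \<in> ocomp Y"
      using orthogonal_projection_exists[OF csubspace_closure[OF Y] closed_closure, of x]
      by (auto simp: ocomp_closure)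
    then have "x - q + y \<in> ocomp (closure Y)"
      using that sub by (auto simp: ocomp_closure)
    then have "norm q \<le> norm (q + (x - q + y))"
      using q(1) by (intro norm_le_norm_add_orthogonal) (auto simp: ocomp_def)
    then have "norm q < d"
      using that(4) by simp
    \<comment> \<open>Since \<open>x\<close> lies in \<open>ocomp X\<close>, its projection to
      \<open>X\<close> is 0.\<close>
    moreover have "norm (0::'a) < d"
      using le_less_trans[OF norm_ge_zero that(4)] by simp
    ultimately show ?thesis
      using C[of x 0 q d] that q by simp
  qed
  show ?thesis
    unfolding closed_sequential_limits
  proof (intro allI impI, elim conjE)
    fix h l assume "\<forall>n. h n \<in> ocomp X + ocomp Y" and h: "h \<longlonglongrightarrow> l"
    then have "\<forall>n. \<exists>x y. x \<in> ocomp X \<and> y \<in> ocomp Y \<and> x \<in> X + Y \<and> h n = x + y"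
      using split by blast
    then obtain f g where fg: "\<And>n. f n \<in> ocomp X" "\<And>n. g n \<in> ocomp Y" "\<And>n. f n \<in> X + Y" "\<And>n. h n = f n + g n"
      by metis
    have "Cauchy f"
    proof (rule metric_CauchyI)
      fix e :: real assume "0 < e"
      \<comment> \<open>The estimate \<open>bound\<close> is not strict; the factor 2 turns it into
        e/2 < e.\<close>
      then have "0 < e / (2 * C)"
        using \<open>C > 0\<close> by simp
      then obtain N where N: "\<And>m n. m \<ge> N \<Longrightarrow> n \<ge> N \<Longrightarrow> dist (h m) (h n) < e / (2 * C)"
        using LIMSEQ_imp_Cauchy[OF h] unfolding Cauchy_def by meson
      have "dist (f m) (f n) < e" if "m \<ge> N" "n \<ge> N" for m n
      proof -
        have "(f m - f n) + (g m - g n) = h m - h n"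
          by (simp add: fg)
        then have "norm ((f m - f n) + (g m - g n)) < e / (2 * C)"
          using N[OF that] by (simp only: dist_norm)
        then have "norm (f m - f n) \<le> C * (e / (2 * C))"
          by (intro bound[of _ "g m - g n"] sub(1) fg
              complex_vector.subspace_diff[OF csubspace_set_plus[OF X Y]])
        then show ?thesis
          using \<open>0 < e\<close> \<open>C > 0\<close> by (simp add: dist_norm)
      qed
      then show "\<exists>N. \<forall>m\<ge>N. \<forall>n\<ge>N. dist (f m) (f n) < e"
        by blast
    qed
    then obtain x where x: "f \<longlonglongrightarrow> x"
      using Cauchy_convergent_iff convergent_def by blast
    then have "(\<lambda>n. h n - f n) \<longlonglongrightarrow> l - x"
      using h by (intro tendsto_diff)
    then have "l - x \<in> ocomp Y"
      using closed_sequentially[OF closed_ocomp, of "\<lambda>n. h n - f n" Y] fg by simp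
    moreover have "x \<in> ocomp X"
      using closed_sequentially[OF closed_ocomp] fg x by blast
    ultimately show "l \<in> ocomp X + ocomp Y"
      using set_plus_intro[of x "ocomp X" "l - x" "ocomp Y"] by simp
  qed
qed

text \<open>For the converse the one-sided result is applied to the complements, whose own
  complements are \<open>X\<close> and \<open>Y\<close> again.\<close>

lemma closed_ocomp_plus_ocomp_iff:
  fixes X Y :: "'a::chilbert_space set"
  assumes "csubspace X" "closed X" "csubspace Y" "closed Y"
  shows "closed (ocomp X + ocomp Y) \<longleftrightarrow> closed (X + Y)"
  using closed_ocomp_plus_ocomp[of X Y] closed_ocomp_plus_ocomp[of "ocomp X" "ocomp Y"] assms
  by (auto simp: csubspace_ocomp ocomp_ocomp)

section \<open>Linear relations\<close>

instantiation prod :: (complex_inner, complex_inner) complex_inner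
begin

definition cinner_prod_def: "cinner p q = cinner (fst p) (fst q) + cinner (snd p) (snd q)"

instance
proof
  fix x y z :: "'a \<times> 'b" and a :: complex
  show "cinner x y = cnj (cinner y x)"
    by (simp add: cinner_prod_def flip: cinner_commute)
  show "cinner (x + y) z = cinner x z + cinner y z"
    by (simp add: cinner_prod_def cinner_add_left)
  show "cinner (a *\<^sub>C x) y = a * cinner x y"
    by (simp add: cinner_prod_def scaleC_prod_def cinner_scaleC_left distrib_left)
  show "cinner x x = complex_of_real ((norm x)\<^sup>2)"
    by (simp add: cinner_prod_def norm_prod_def cinner_self)
qed

end

instance prod :: (chilbert_space, chilbert_space) chilbert_space ..

text \<open>Test pairs with one coordinate 0 separate the two conditions.\<close>

lemma ocomp_Times:
  assumes "csubspace X" "csubspace Y"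
  shows "ocomp (X \<times> Y) = ocomp X \<times> ocomp Y"
proof -
  have 0: "0 \<in> X" "0 \<in> Y"
    using assms[THEN complex_vector.subspace_0] .
  show ?thesis
  proof (intro equalityI subrelI)
    fix a b assume "(a, b) \<in> ocomp (X \<times> Y)"
    then have eq: "cinner x a + cinner y b = 0" if "x \<in> X" "y \<in> Y" for x y
      using that by (auto simp: ocomp_def cinner_prod_def)
    show "(a, b) \<in> ocomp X \<times> ocomp Y"
      using eq[OF _ 0(2)] eq[OF 0(1)] by (auto simp: ocomp_def)
  qed (auto simp: ocomp_def cinner_prod_def)
qed

lemma closed_radjoint: "closed (radjoint T)"
proof -
  have "radjoint T = {p. \<forall>t\<in>T. cinner (snd t) (fst p) = cinner (fst t) (snd p)}"
    by (simp add: radjoint_def split_beta set_eq_iff)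
  also have "\<dots> = (\<Inter>t\<in>T. {p. cinner (snd t) (fst p) = cinner (fst t) (snd p)})"
    by auto
  finally have "radjoint T = (\<Inter>t\<in>T. {p. cinner (snd t) (fst p) = cinner (fst t) (snd p)})" .
  then show ?thesis
    by (auto intro!: closed_Collect_eq continuous_intros)
qed

text \<open>The adjoint is the orthogonal complement twisted by the rotation \<open>(f, g) \<mapsto> (g, - f)\<close>, whose
  square is \<open>- 1\<close>.\<close>

lemma radjoint_radjoint:
  fixes T :: "('a::chilbert_space \<times> 'a) set"
  assumes "csubspace T"
  shows "radjoint (radjoint T) = closure T"
proof -
  have iff: "(x, y) \<in> radjoint R \<longleftrightarrow> (y, - x) \<in> ocomp R" for x y and R :: "('a \<times> 'a) set"
    by (auto simp: radjoint_def ocomp_def cinner_prod_def)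
  have iff': "(u, v) \<in> ocomp T \<longleftrightarrow> (- v, u) \<in> radjoint T" for u v
    by (simp add: iff)
  have "radjoint (radjoint T) = ocomp (ocomp T)"
  proof (intro equalityI subrelI)
    fix x y assume *: "(x, y) \<in> radjoint (radjoint T)"
    have "cinner u x + cinner v y = 0" if "(u, v) \<in> ocomp T" for u v
    proof -
      have "cinner u x = cinner (- v) y"
        using * that unfolding radjoint_def[of "radjoint T"] iff' by blast
      then show ?thesis
        by simp
    qed
    then show "(x, y) \<in> ocomp (ocomp T)"
      by (force simp: ocomp_def[of "ocomp T"] cinner_prod_def)
  next
    fix x y assume *: "(x, y) \<in> ocomp (ocomp T)"
    have "cinner v x = cinner u y" if "(u, v) \<in> radjoint T" for u v
    proof -
      have "cinner (v, - u) (x, y) = 0"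
        using * that[unfolded iff] by (auto simp: ocomp_def[of "ocomp T"])
      then show ?thesis
        by (simp add: cinner_prod_def)
    qed
    then show "(x, y) \<in> radjoint (radjoint T)"
      by (subst radjoint_def) auto
  qed
  then show ?thesis
    using ocomp_ocomp[OF assms] by simp
qed

section \<open>The relations \<open>proj_rel3\<close>: adjoint, closedness, idempotency\<close>

lemma proj_rel3_eq: "proj_rel3 M N S = {(m + n, m + s) | m n s. m \<in> M \<and> n \<in> N \<and> s \<in> S}"
  for M :: "'a::monoid_add set"
  unfolding proj_rel3_def proj_rel_def set_plus_def by auto

lemma csubspace_proj_rel3:
  assumes "csubspace M" "csubspace N" "csubspace S"
  shows "csubspace (proj_rel3 M N S)"
proof (rule complex_vector.subspaceI)
  have "(0 + 0, 0 + 0) \<in> proj_rel3 M N S"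
    unfolding proj_rel3_eq using assms[THEN complex_vector.subspace_0] by blast
  then show "0 \<in> proj_rel3 M N S"
    by (simp add: zero_prod_def)
next
  fix p q assume "p \<in> proj_rel3 M N S" "q \<in> proj_rel3 M N S"
  then obtain m n s m' n' s' where *: "p = (m + n, m + s)" "q = (m' + n', m' + s')"
    "m \<in> M" "m' \<in> M" "n \<in> N" "n' \<in> N" "s \<in> S" "s' \<in> S"
    unfolding proj_rel3_eq by blast
  then have "p + q = ((m + m') + (n + n'), (m + m') + (s + s'))"
    by (simp add: algebra_simps)
  moreover have "m + m' \<in> M" "n + n' \<in> N" "s + s' \<in> S"
    using * assms by (auto intro: complex_vector.subspace_add)
  ultimately show "p + q \<in> proj_rel3 M N S"
    unfolding proj_rel3_eq by blast
next
  fix c p assume "p \<in> proj_rel3 M N S"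
  then obtain m n s where *: "p = (m + n, m + s)" "m \<in> M" "n \<in> N" "s \<in> S"
    unfolding proj_rel3_eq by blast
  then have "c *\<^sub>C p = (c *\<^sub>C m + c *\<^sub>C n, c *\<^sub>C m + c *\<^sub>C s)"
    by (simp add: scaleC_prod_def scaleC_add_right)
  moreover have "c *\<^sub>C m \<in> M" "c *\<^sub>C n \<in> N" "c *\<^sub>C s \<in> S"
    using * assms by (auto intro: complex_vector.subspace_scale)
  ultimately show "c *\<^sub>C p \<in> proj_rel3 M N S"
    unfolding proj_rel3_eq by blast
qed

text \<open>The defining equation is linear in \<open>m\<close>, \<open>n\<close> and
  \<open>s\<close>, so it splits into three conditions, each obtained by setting the other two
  vectors to 0.\<close>

lemma radjoint_proj_rel3:
  assumes "csubspace M" "csubspace N" "csubspace S"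
  shows "radjoint (proj_rel3 M N S) = {(x, y). x \<in> ocomp S \<and> y \<in> ocomp N \<and> x - y \<in> ocomp M}"
proof (intro equalityI subrelI)
  fix x y assume "(x, y) \<in> radjoint (proj_rel3 M N S)"
  then have eq: "cinner (m + s) x = cinner (m + n) y" if "m \<in> M" "n \<in> N" "s \<in> S" for m n s
    using that unfolding radjoint_def proj_rel3_eq by blast
  have 0: "0 \<in> M" "0 \<in> N" "0 \<in> S"
    using assms[THEN complex_vector.subspace_0] .
  show "(x, y) \<in> {(x, y). x \<in> ocomp S \<and> y \<in> ocomp N \<and> x - y \<in> ocomp M}"
    using eq[OF 0(1,2)] eq[OF 0(1) _ 0(3)] eq[OF _ 0(2,3)] by (auto simp: ocomp_def cinner_diff_right)
next
  fix x y assume "(x, y) \<in> {(x, y). x \<in> ocomp S \<and> y \<in> ocomp N \<and> x - y \<in> ocomp M}"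
  then show "(x, y) \<in> radjoint (proj_rel3 M N S)"
    by (auto simp: radjoint_def proj_rel3_eq ocomp_def cinner_diff_right cinner_add_left)
qed

text \<open>\<open>P\<^bsub>V,U,W\<^esub>\<close> is the sum of \<open>U \<times> W\<close> and the diagonal of \<open>V\<close>, so the criterion for orthogonal
  complements applies in the product space.\<close>

lemma closed_proj_rel3_iff:
  fixes U V W :: "'a::chilbert_space set"
  assumes sub: "csubspace U" "csubspace V" "csubspace W" and cl: "closed U" "closed V" "closed W"
  shows "closed (proj_rel3 V U W) \<longleftrightarrow> closed (ocomp U + ocomp V + ocomp W)"
proof -
  let ?D = "(\<lambda>v. (v, v)) ` V" and ?Q = "ocomp U + ocomp V + ocomp W"
  have UW: "csubspace (U \<times> W)" "closed (U \<times> W)"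
    using sub cl by (auto simp: complex_vector.subspace_def scaleC_prod_def zero_prod_def closed_Times)
  have D_eq: "?D = {p. fst p \<in> V \<and> snd p = fst p}"
    by force
  have "{p. fst p \<in> V \<and> snd p = fst p} = fst -` V \<inter> {p. snd p = fst p}"
    by auto
  then have D: "csubspace ?D" "closed ?D"
    unfolding D_eq using sub(2) cl(2)
    by (auto simp: complex_vector.subspace_def scaleC_prod_def
        intro!: closed_Int closed_vimage_fst closed_Collect_eq continuous_intros)
  have "proj_rel3 V U W = U \<times> W + ?D"
    unfolding proj_rel3_eq set_plus_def by (auto simp: add.commute) (metis add.commute)+
  then have "closed (proj_rel3 V U W) \<longleftrightarrow> closed (ocomp (U \<times> W) + ocomp ?D)"
    using closed_ocomp_plus_ocomp_iff[OF UW D] by simp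
  \<comment> \<open>Pairing \<open>(v, v)\<close> with \<open>(x, y)\<close> gives the pairing of
    \<open>v\<close> with \<open>x + y\<close>.\<close>
  also have "ocomp ?D = {(x, y). x + y \<in> ocomp V}"
    by (auto simp: ocomp_def cinner_prod_def cinner_add_right)
  also have "ocomp (U \<times> W) = ocomp U \<times> ocomp W"
    using sub by (intro ocomp_Times)
  also have "ocomp U \<times> ocomp W + {(x, y). x + y \<in> ocomp V} = (\<lambda>p. fst p + snd p) -` ?Q"
  proof (intro equalityI subsetI)
    fix p assume "p \<in> ocomp U \<times> ocomp W + {(x, y). x + y \<in> ocomp V}"
    then obtain u w x y where "p = (u + x, w + y)" "u \<in> ocomp U" "w \<in> ocomp W" "x + y \<in> ocomp V"
      by (auto elim!: set_plus_elim)
    moreover from this have "u + (x + y) + w \<in> ?Q"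
      by (intro set_plus_intro)
    ultimately show "p \<in> (\<lambda>p. fst p + snd p) -` ?Q"
      by (simp add: algebra_simps)
  next
    fix p assume "p \<in> (\<lambda>p. fst p + snd p) -` ?Q"
    then obtain u v w where *: "fst p + snd p = u + v + w" "u \<in> ocomp U" "v \<in> ocomp V" "w \<in> ocomp W"
      by (auto elim!: set_plus_elim)
    \<comment> \<open>Once \<open>(u, w)\<close> is subtracted from \<open>p\<close>, the
      coordinates of the rest add up to \<open>v\<close>.\<close>
    then have "(fst p - u) + (snd p - w) = v"
      by (simp add: algebra_simps)
    then have "(u, w) + (fst p - u, snd p - w) \<in> ocomp U \<times> ocomp W + {(x, y). x + y \<in> ocomp V}"
      using * by (intro set_plus_intro) auto
    then show "p \<in> ocomp U \<times> ocomp W + {(x, y). x + y \<in> ocomp V}"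
      by simp
  qed
  also have "closed ((\<lambda>p. fst p + snd p) -` ?Q) \<longleftrightarrow> closed ?Q"
  proof
    assume "closed ?Q"
    then show "closed ((\<lambda>p. fst p + snd p) -` ?Q)"
      by (intro continuous_closed_vimage continuous_intros)
  next
    assume "closed ((\<lambda>p. fst p + snd p) -` ?Q)"
    \<comment> \<open>The map to \<open>(x, 0)\<close> is a continuous right inverse of addition, so
      pulling back along it recovers \<open>?Q\<close>.\<close>
    then have "closed ((\<lambda>x. (x, 0 :: 'a)) -` ((\<lambda>p. fst p + snd p) -` ?Q))"
      by (rule continuous_closed_vimage) (intro continuous_intros)
    moreover have "(\<lambda>x. (x, 0 :: 'a)) -` ((\<lambda>p. fst p + snd p) -` ?Q) = ?Q"
      by auto
    ultimately show "closed ?Q"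
      by (simp only:)
  qed
  finally show ?thesis .
qed

lemma idempotent_radjoint_proj_rel3_iff:
  fixes M N S :: "'a::complex_inner set"
  assumes sub: "csubspace M" "csubspace N" "csubspace S"
  defines "G \<equiv> proj_rel3 (ocomp N \<inter> ocomp S) (ocomp M \<inter> ocomp S) (ocomp M \<inter> ocomp N)"
  shows "G \<subseteq> radjoint (proj_rel3 M N S)"
    and "idempotent_rel (radjoint (proj_rel3 M N S)) \<longleftrightarrow> radjoint (proj_rel3 M N S) = G"
proof -
  let ?F = "radjoint (proj_rel3 M N S)"
  note F = radjoint_proj_rel3[OF sub]
  note add = csubspace_ocomp[THEN complex_vector.subspace_add]
  note diff = csubspace_ocomp[THEN complex_vector.subspace_diff]
  show G_F: "G \<subseteq> ?F"
  proof
    fix p assume "p \<in> G"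
    then obtain v u w where "p = (v + u, v + w)" "v \<in> ocomp N" "v \<in> ocomp S"
        "u \<in> ocomp M" "u \<in> ocomp S" "w \<in> ocomp M" "w \<in> ocomp N"
      unfolding G_def proj_rel3_eq by blast
    then show "p \<in> ?F"
      unfolding F by (auto intro: add diff)
  qed
  have "?F O ?F \<subseteq> ?F"
  \<comment> \<open>The differences \<open>x - z\<close> and \<open>z - y\<close> add up to
    \<open>x - y\<close> inside \<open>ocomp M\<close>.\<close>
  proof (intro subrelI, elim relcompEpair)
    fix x z y assume "(x, z) \<in> ?F" "(z, y) \<in> ?F"
    then show "(x, y) \<in> ?F"
      unfolding F using add[of "x - z" M "z - y"] by auto
  qed
  moreover have "?F \<subseteq> ?F O ?F \<longleftrightarrow> ?F \<subseteq> G"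
  proof
    assume *: "?F \<subseteq> ?F O ?F"
    show "?F \<subseteq> G"
    proof (intro subrelI)
      fix x y assume "(x, y) \<in> ?F"
      then obtain z where z: "(x, z) \<in> ?F" "(z, y) \<in> ?F"
        using * by blast
      \<comment> \<open>The intermediate point is the common part: as a second coordinate it lies in
        \<open>ocomp N\<close>, as a first one in \<open>ocomp S\<close>.\<close>
      then have "z \<in> ocomp N" "z \<in> ocomp S" "x - z \<in> ocomp M" "x - z \<in> ocomp S"
        "y - z \<in> ocomp N" "- (z - y) \<in> ocomp M"
        unfolding F by (auto intro: diff complex_vector.subspace_neg csubspace_ocomp simp del: minus_diff_eq)
      then have "(z + (x - z), z + (y - z)) \<in> G"
        unfolding G_def proj_rel3_eq minus_diff_eq by blast
      then show "(x, y) \<in> G"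
        by simp
    qed
  next
    assume *: "?F \<subseteq> G"
    show "?F \<subseteq> ?F O ?F"
    proof (intro subrelI)
      fix x y assume "(x, y) \<in> ?F"
      then have "(x, y) \<in> G"
        using * by blast
      then obtain v u w where vuw: "x = v + u" "y = v + w" "v \<in> ocomp N" "v \<in> ocomp S"
        "u \<in> ocomp M" "u \<in> ocomp S" "w \<in> ocomp M" "w \<in> ocomp N"
        unfolding G_def proj_rel3_eq by blast
      \<comment> \<open>Conversely \<open>v\<close> is an intermediate point: each of the two pairs
        drops one of \<open>w\<close> and \<open>u\<close>.\<close>
      then have "(x, v) \<in> ?F" "(v, y) \<in> ?F"
        unfolding F using diff[of 0 M w] csubspace_ocomp[of M, THEN complex_vector.subspace_0]
        by (auto intro: add)
      then show "(x, y) \<in> ?F O ?F"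
        by blast
    qed
  qed
  ultimately show "idempotent_rel ?F \<longleftrightarrow> ?F = G"
    using G_F unfolding idempotent_rel_def by blast
qed

theorem theorem5p12:
  fixes M N S :: "'a::chilbert_space set"
    and E :: "('a \<times> 'a) set"
  assumes "separable_space (euclidean :: 'a topology)"
    and "csubspace M" and "csubspace N" and "csubspace S"
    and "idempotency_condition M N S"
    and "E = proj_rel3 M N S"
  shows "idempotent_rel (radjoint E) \<longleftrightarrow>
    closure E = proj_rel (closure (M + S)) (closure (N + S)) \<inter> (closure (M + N) \<times> UNIV) \<and>
    closed (closure (M + S) + closure (N + S) + closure (M + N))"
proof -
  note sub = assms(2-4)
  let ?U = "ocomp M \<inter> ocomp S" and ?V = "ocomp N \<inter> ocomp S" and ?W = "ocomp M \<inter> ocomp N"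
  let ?F = "radjoint E" and ?G = "proj_rel3 ?V ?U ?W"
  have UVW: "csubspace ?U" "csubspace ?V" "csubspace ?W" "closed ?U" "closed ?V" "closed ?W"
    by (simp_all add: complex_vector.subspace_inter csubspace_ocomp closed_Int closed_ocomp)
  have "ocomp (ocomp X \<inter> ocomp Y) = closure (X + Y)" if "csubspace X" "csubspace Y" for X Y :: "'a set"
    using ocomp_ocomp[OF csubspace_set_plus[OF that]] ocomp_set_plus[OF that] by simp
  then have ocomps: "ocomp ?U = closure (M + S)" "ocomp ?V = closure (N + S)" "ocomp ?W = closure (M + N)"
    using sub by auto
  have adj_G: "radjoint ?G = proj_rel (closure (M + S)) (closure (N + S)) \<inter> (closure (M + N) \<times> UNIV)"
  proof -
    \<comment> \<open>The second coordinate is the summand in \<open>X\<close>, which determines the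
      other as \<open>x - y\<close>.\<close>
    have "(x, y) \<in> proj_rel X Y \<longleftrightarrow> y \<in> X \<and> x - y \<in> Y" for x y and X Y :: "'a set"
      unfolding proj_rel_def by (auto intro!: exI[of _ y] exI[of _ "x - y"])
    then show ?thesis
      unfolding radjoint_proj_rel3[OF UVW(2,1,3)] ocomps by auto
  qed
  have adj_F: "radjoint ?F = closure E"
    using radjoint_radjoint[OF csubspace_proj_rel3[OF sub]] assms(6) by simp
  have closed_G: "closed ?G \<longleftrightarrow> closed (closure (M + S) + closure (N + S) + closure (M + N))"
    using closed_proj_rel3_iff[OF UVW] by (simp add: ocomps)
  \<comment> \<open>Equal adjoints have equal double adjoints, that is, equal closures, and
    \<open>?F\<close> is closed as an adjoint. Hence closedness of \<open>?G\<close> is exactly what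
    equality still requires.\<close>
  have "?F = ?G \<longleftrightarrow> radjoint ?F = radjoint ?G \<and> closed ?G"
    using radjoint_radjoint[OF csubspace_radjoint, of E] radjoint_radjoint[OF csubspace_proj_rel3[OF UVW(2,1,3)]]
      closed_radjoint[of E] by (metis closure_closed)
  then show ?thesis
    using idempotent_radjoint_proj_rel3_iff(2)[OF sub] assms(6) adj_F adj_G closed_G by simp
qed

end
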